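(* Let $h=(h_s)_{s\in D}\in K_2$ and $(f,x,q,d)\in K_1$. Then $(f,x,q,d)$ is a solution of the parametric variational inequality $$\sum_{r\in O}\sum_{s\in D}\sum_{k\in R_{rs}}(\tilde f_k^{rs}-f_k^{rs})\tfrac1\alpha\ln f_k^{rs}+\sum_{a\in A}(\tilde x_a-x_a)t_a(x_a)+\sum_{r\in O}\sum_{s\in D}(\tilde q_{rs}-q_{rs})\left(\tfrac1\gamma-\tfrac1\alpha\right)\ln q_{rs}-\sum_{s\in D}(\tilde d_s-d_s)A_s(d_s,h_s)\ge 0\quad\text{for all }(\tilde f,\tilde x,\tilde q,\tilde d)\in K_1$$ if and only if $(f,x,q,d)$ is a parametric traffic equilibrium for the parameter $h$, i.e. if and only if $$q_{rs}=O_r\frac{\exp\{-\gamma[v_{rs}-A_s(d_s,h_s)]\}}{\sum_{j\in D}\exp\{-\gamma[v_{rj}-A_j(d_j,h_j)]\}}\quad\text{for all } r\in O,\ s\in D,$$ $$f_k^{rs}=q_{rs}\frac{\exp\{-\alpha\sum_{a\in A}\delta_{ak}^{rs}t_a(x_a)\}}{\sum_{j\in R_{rs}}\exp\{-\alpha\sum_{a\in A}\delta_{aj}^{rs}t_a(x_a)\}}\quad\text{for all } k\in R_{rs},\ r\in O,\ s\in D,$$ where $v_{rs}=-\frac1\alpha\ln\left\{\sum_{j\in R_{rs}}\exp\left[-\alpha\sum_{a\in A}\delta_{aj}^{rs}t_a(x_a)\right]\right\}$.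
   Context: $G=(V,A)$ is a finite directed network with link set $A$, finite nonempty origin set $O$ and destination set $D$ (every destination is a business center). For $r\in O$, $s\in D$, $R_{rs}$ is the (finite, nonempty) set of simple routes from $r$ to $s$; $\delta_{ak}^{rs}=1$ if link $a$ lies on route $k\in R_{rs}$ and $0$ otherwise. $O_r>0$ is the fixed travel demand from origin $r$, and $T>0$ is the fixed total number of business companies. Variables: path flows $f=(f_k^{rs})$, link flows $x=(x_a)$, origin-destination demands $q=(q_{rs})$, destination demands $d=(d_s)$, business flows $h=(h_s)$. $$K_1=\Big\{(f,x,q,d): f_k^{rs}\ge0,\ \sum_{k\in R_{rs}}f_k^{rs}=q_{rs},\ \sum_{s\in D}q_{rs}=O_r,\ \sum_{r\in O}\sum_{s\in D}\sum_{k\in R_{rs}}\delta_{ak}^{rs}f_k^{rs}=x_a,\ \sum_{r\in O}q_{rs}=d_s\ \ \forall k\in R_{rs},r\in O,s\in D,a\in A\Big\},$$ $$K_2=\Big\{h: h_s\ge0\ \forall s\in D,\ \sum_{s\in D}h_s=T\Big\}.$$ Parameters: $\alpha,\gamma>0$ with $\alpha\ge\gamma$. Standing assumptions on functions of nonnegative real arguments: each link travel time $t_a(x_a)$ is convex, continuously differentiable and strictly increasing; each trip attraction function $A_s(d_s,h_s)$ is continuously differentiable, strictly decreasing and strictly concave in $d_s$, and strictly increasing in $h_s$. Convention: since the variational inequality contains logarithms evaluated at the candidate solution, a solution is understood to have all components $f_k^{rs}>0$ and $q_{rs}>0$. *)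

theory Defs
  imports "HOL-Analysis.Analysis" "Graph_Theory.Arc_Walk"
begin

section \<open>Regularity notions for cost and attraction functions\<close>

text \<open>
  The derivative is taken relative to \<open>S\<close>, so at the boundary of \<open>{0..}\<close> or of
  \<open>{0..} \<times> {0..}\<close> it is one-sided.
\<close>

definition cont_diff_on :: "'a::real_normed_vector set \<Rightarrow> ('a \<Rightarrow> real) \<Rightarrow> bool" where
  "cont_diff_on S g \<longleftrightarrow>
     (\<exists>g' :: 'a \<Rightarrow> 'a \<Rightarrow>\<^sub>L real.
        (\<forall>z\<in>S. (g has_derivative blinfun_apply (g' z)) (at z within S)) \<and> continuous_on S g')"

definition strictly_concave_on :: "'a::real_vector set \<Rightarrow> ('a \<Rightarrow> real) \<Rightarrow> bool" where
  "strictly_concave_on S g \<longleftrightarrow> convex S \<and>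
     (\<forall>y\<in>S. \<forall>z\<in>S. \<forall>u. y \<noteq> z \<longrightarrow> 0 < u \<longrightarrow> u < 1 \<longrightarrow>
        (1 - u) * g y + u * g z < g ((1 - u) *\<^sub>R y + u *\<^sub>R z))"

definition travel_time_fun :: "(real \<Rightarrow> real) \<Rightarrow> bool" where
  "travel_time_fun g \<longleftrightarrow> convex_on {0..} g \<and> cont_diff_on {0..} g \<and> strict_mono_on {0..} g"

definition attraction_fun :: "(real \<Rightarrow> real \<Rightarrow> real) \<Rightarrow> bool" where
  "attraction_fun g \<longleftrightarrow>
     cont_diff_on ({0..} \<times> {0..}) (\<lambda>(y, z). g y z) \<and>
     (\<forall>z\<ge>0. strict_antimono_on {0..} (\<lambda>y. g y z) \<and> strictly_concave_on {0..} (\<lambda>y. g y z)) \<and>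
     (\<forall>y\<ge>0. strict_mono_on {0..} (\<lambda>z. g y z))"

section \<open>Routes and feasible flows\<close>

text \<open>
  Routes are lists of arcs. If an origin coincides with a destination, the only simple route
  between them is the empty one.
\<close>

definition routes :: "('v, 'l) pre_digraph \<Rightarrow> 'v \<Rightarrow> 'v \<Rightarrow> 'l list set" where
  "routes G r s = {k. pre_digraph.apath G r k s}"

lemma finite_routes:
  assumes "fin_digraph G"
  shows "finite (routes G r s)"
proof -
  interpret fin_digraph G by fact
  have "routes G r s \<subseteq> {k. set k \<subseteq> arcs G \<and> length k \<le> card (verts G)}"
    using length_apath_less by (fastforce simp: routes_def apath_def awalk_def less_imp_le)
  then show ?thesis
    by (rule finite_subset) (rule finite_lists_length_le, simp)
qed

definition incidence :: "'l \<Rightarrow> 'l list \<Rightarrow> real" where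
  "incidence a k = (if a \<in> set k then 1 else 0)"

text \<open>
  A flow vector consists of path flows \<open>f r s k\<close>, link flows \<open>x a\<close>, origin-destination
  demands \<open>q r s\<close> and destination demands \<open>d s\<close>. Only the values at origins \<open>r\<close>,
  destinations \<open>s\<close>, routes \<open>k\<close> and links \<open>a\<close> of the network are relevant.
\<close>

type_synonym ('v, 'l) flow_vector =
  "('v \<Rightarrow> 'v \<Rightarrow> 'l list \<Rightarrow> real) \<times> ('l \<Rightarrow> real) \<times> ('v \<Rightarrow> 'v \<Rightarrow> real) \<times> ('v \<Rightarrow> real)"

definition K1 :: "('v, 'l) pre_digraph \<Rightarrow> 'v set \<Rightarrow> 'v set \<Rightarrow> ('v \<Rightarrow> real) \<Rightarrow> ('v, 'l) flow_vector set"
  where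
  "K1 G Or De dem = {(f, x, q, d).
     (\<forall>r\<in>Or. \<forall>s\<in>De. \<forall>k\<in>routes G r s. f r s k \<ge> 0) \<and>
     (\<forall>r\<in>Or. \<forall>s\<in>De. (\<Sum>k\<in>routes G r s. f r s k) = q r s) \<and>
     (\<forall>r\<in>Or. (\<Sum>s\<in>De. q r s) = dem r) \<and>
     (\<forall>a\<in>arcs G. (\<Sum>r\<in>Or. \<Sum>s\<in>De. \<Sum>k\<in>routes G r s. incidence a k * f r s k) = x a) \<and>
     (\<forall>s\<in>De. (\<Sum>r\<in>Or. q r s) = d s)}"

definition K2 :: "'v set \<Rightarrow> real \<Rightarrow> ('v \<Rightarrow> real) set" where
  "K2 De T = {h. (\<forall>s\<in>De. h s \<ge> 0) \<and> (\<Sum>s\<in>De. h s) = T}"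

section \<open>The parametric variational inequality and the parametric equilibrium\<close>

text \<open>
  The logarithms in the variational inequality are evaluated at the candidate solution, so a
  solution is required to have positive path flows and origin-destination demands.
\<close>

definition solves_parametric_VI ::
  "('v, 'l) pre_digraph \<Rightarrow> 'v set \<Rightarrow> 'v set \<Rightarrow> ('v \<Rightarrow> real) \<Rightarrow> real \<Rightarrow> real \<Rightarrow>
   ('l \<Rightarrow> real \<Rightarrow> real) \<Rightarrow> ('v \<Rightarrow> real \<Rightarrow> real \<Rightarrow> real) \<Rightarrow> ('v \<Rightarrow> real) \<Rightarrow>
   ('v, 'l) flow_vector \<Rightarrow> bool" where
  "solves_parametric_VI G Or De dem \<alpha> \<gamma> t A h = (\<lambda>(f, x, q, d).
     (f, x, q, d) \<in> K1 G Or De dem \<and>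
     (\<forall>r\<in>Or. \<forall>s\<in>De. \<forall>k\<in>routes G r s. f r s k > 0) \<and>
     (\<forall>r\<in>Or. \<forall>s\<in>De. q r s > 0) \<and>
     (\<forall>(f', x', q', d') \<in> K1 G Or De dem.
        (\<Sum>r\<in>Or. \<Sum>s\<in>De. \<Sum>k\<in>routes G r s. (f' r s k - f r s k) * ((1 / \<alpha>) * ln (f r s k)))
      + (\<Sum>a\<in>arcs G. (x' a - x a) * t a (x a))
      + (\<Sum>r\<in>Or. \<Sum>s\<in>De. (q' r s - q r s) * ((1 / \<gamma> - 1 / \<alpha>) * ln (q r s)))
      - (\<Sum>s\<in>De. (d' s - d s) * A s (d s) (h s)) \<ge> 0))"

definition route_cost ::
  "('v, 'l) pre_digraph \<Rightarrow> ('l \<Rightarrow> real \<Rightarrow> real) \<Rightarrow> ('l \<Rightarrow> real) \<Rightarrow> 'l list \<Rightarrow> real" where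
  "route_cost G t x k = (\<Sum>a\<in>arcs G. incidence a k * t a (x a))"

definition expected_cost ::
  "('v, 'l) pre_digraph \<Rightarrow> real \<Rightarrow> ('l \<Rightarrow> real \<Rightarrow> real) \<Rightarrow> ('l \<Rightarrow> real) \<Rightarrow> 'v \<Rightarrow> 'v \<Rightarrow> real" where
  "expected_cost G \<alpha> t x r s = - (1 / \<alpha>) * ln (\<Sum>j\<in>routes G r s. exp (- \<alpha> * route_cost G t x j))"

definition parametric_equilibrium ::
  "('v, 'l) pre_digraph \<Rightarrow> 'v set \<Rightarrow> 'v set \<Rightarrow> ('v \<Rightarrow> real) \<Rightarrow> real \<Rightarrow> real \<Rightarrow>
   ('l \<Rightarrow> real \<Rightarrow> real) \<Rightarrow> ('v \<Rightarrow> real \<Rightarrow> real \<Rightarrow> real) \<Rightarrow> ('v \<Rightarrow> real) \<Rightarrow>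
   ('v, 'l) flow_vector \<Rightarrow> bool" where
  "parametric_equilibrium G Or De dem \<alpha> \<gamma> t A h = (\<lambda>(f, x, q, d).
     (\<forall>r\<in>Or. \<forall>s\<in>De.
        q r s = dem r *
          (exp (- \<gamma> * (expected_cost G \<alpha> t x r s - A s (d s) (h s))) /
           (\<Sum>j\<in>De. exp (- \<gamma> * (expected_cost G \<alpha> t x r j - A j (d j) (h j)))))) \<and>
     (\<forall>r\<in>Or. \<forall>s\<in>De. \<forall>k\<in>routes G r s.
        f r s k = q r s *
          (exp (- \<alpha> * route_cost G t x k) /
           (\<Sum>j\<in>routes G r s. exp (- \<alpha> * route_cost G t x j)))))"

end

theory Submission
  imports Defs
begin

text \<open>
  On the network, a point of \<open>K1\<close> is determined by its path flows, and these range over a product of simplices,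
  one for each origin \<open>r\<close>: nonnegative flows on all pairs (destination, route) leaving \<open>r\<close>, with
  total \<open>dem r\<close>. Substituting the conservation equations, the left-hand side of the variational
  inequality becomes the linear form \<open>\<Sum> (f' - f) * c\<close> in the path flows alone, with
  \<open>c = (1/\<alpha>) ln f + C + (1/\<gamma> - 1/\<alpha>) ln q - A\<close>, where \<open>C\<close> is the travel time of the route
  (\<open>K1_VI_as_path_cost\<close>, with \<open>c\<close> called \<open>marginal_cost\<close>).

  At a point in the relative interior of a product of simplices, such a form is nonnegative in all
  feasible directions iff \<open>c\<close> is constant on each simplex (\<open>VI_on_simplices_iff\<close>). So the
  inequality says exactly that \<open>c\<close> depends only on the origin.

  Constancy of \<open>(1/\<theta>) ln p + u\<close> is in turn the logit formula for \<open>p\<close> with utilities \<open>- u\<close>, and the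
  common value is a shifted log-sum (\<open>logit_iff_constant_cost\<close>, \<open>logit_iff_logsum_cost\<close>). This is used twice. For fixed
  \<open>r\<close> and \<open>s\<close> it gives the route choice formula with parameter \<open>\<alpha>\<close>, and the common value
  \<open>(1/\<alpha>) ln q + v\<close> merges with the demand term to leave \<open>(1/\<gamma>) ln q + v - A\<close>. For
  fixed \<open>r\<close> the same criterion with parameter \<open>\<gamma>\<close> is then the destination choice formula.
  Conversely, the two formulas force positive demands and path flows, so the logarithms make sense
  at any equilibrium.
\<close>

section \<open>Variational inequalities on products of simplices\<close>

text \<open>
  Since all masses are positive, the whole mass of any \<open>j\<close> can be moved to any other \<open>j'\<close> of the same
  block, which costs \<open>f i j * (c i j' - c i j)\<close>. If this is never negative, all costs in the block agree.
  If the costs agree, the form vanishes because mass is conserved in each block.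
\<close>

lemma VI_on_simplices_iff:
  fixes f c :: "'i \<Rightarrow> 'j \<Rightarrow> real"
  assumes fin: "finite I" "\<And>i. i \<in> I \<Longrightarrow> finite (J i)"
    and pos: "\<And>i j. i \<in> I \<Longrightarrow> j \<in> J i \<Longrightarrow> f i j > 0"
  shows "(\<forall>g. (\<forall>i\<in>I. \<forall>j\<in>J i. g i j \<ge> 0) \<and> (\<forall>i\<in>I. sum (g i) (J i) = sum (f i) (J i)) \<longrightarrow>
              (\<Sum>i\<in>I. \<Sum>j\<in>J i. (g i j - f i j) * c i j) \<ge> 0) \<longleftrightarrow>
         (\<forall>i\<in>I. \<forall>j\<in>J i. \<forall>j'\<in>J i. c i j = c i j')"
    (is "?VI \<longleftrightarrow> ?const")
proof
  assume VI: ?VI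
  have le: "c i j \<le> c i j'" if i: "i \<in> I" and j: "j \<in> J i" "j' \<in> J i" for i j j'
  proof (cases "j = j'")
    case False
    \<comment> \<open>The deviation that moves the whole mass of \<open>j\<close> to \<open>j'\<close>.\<close>
    define e where
      "e = (\<lambda>i' l. if i' = i then (if l = j' then f i j else 0) - (if l = j then f i j else 0) else 0)"
    have e_sum: "(\<Sum>l\<in>J i. e i l * w l) = f i j * (w j' - w j)" for w :: "'j \<Rightarrow> real"
    proof -
      have "(\<Sum>l\<in>J i. e i l * w l) =
          (\<Sum>l\<in>J i. (if l = j' then f i j * w l else 0) - (if l = j then f i j * w l else 0))"
        by (rule sum.cong) (auto simp: e_def)
      also have "\<dots> = f i j * w j' - f i j * w j"
        using j fin(2)[OF i] by (simp add: sum_subtractf)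
      finally show ?thesis by (simp add: algebra_simps)
    qed
    have "sum (\<lambda>l. f i' l + e i' l) (J i') = sum (f i') (J i')" if "i' \<in> I" for i'
      using e_sum[of "\<lambda>_. 1"] by (cases "i' = i") (simp_all add: sum.distrib e_def)
    moreover have "f i' l + e i' l \<ge> 0" if "i' \<in> I" "l \<in> J i'" for i' l
      using pos[OF that] pos[OF i j(1)] False by (auto simp: e_def)
    ultimately have "(\<Sum>i'\<in>I. \<Sum>l\<in>J i'. e i' l * c i' l) \<ge> 0"
      using VI[rule_format, of "\<lambda>i' l. f i' l + e i' l"] by simp
    moreover have "(\<Sum>i'\<in>I. \<Sum>l\<in>J i'. e i' l * c i' l) =
        (\<Sum>i'\<in>I. if i' = i then \<Sum>l\<in>J i. e i l * c i l else 0)"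
      by (rule sum.cong) (auto simp: e_def)
    ultimately have "0 \<le> f i j * (c i j' - c i j)"
      using fin(1) i e_sum[of "c i"] by simp
    then show ?thesis
      using pos[OF i j(1)] by (simp add: zero_le_mult_iff)
  qed simp
  show ?const
    by (intro ballI order_antisym le)
next
  assume const: ?const
  show ?VI
  proof (intro allI impI)
    fix g
    assume g: "(\<forall>i\<in>I. \<forall>j\<in>J i. g i j \<ge> 0) \<and> (\<forall>i\<in>I. sum (g i) (J i) = sum (f i) (J i))"
    have "(\<Sum>j\<in>J i. (g i j - f i j) * c i j) = 0" if i: "i \<in> I" for i
    proof (cases "J i = {}")
      case False
      then obtain j0 where j0: "j0 \<in> J i" by blast
      have "c i j = c i j0" if "j \<in> J i" for j
        using const i j0 that by blast
      then have "(\<Sum>j\<in>J i. (g i j - f i j) * c i j) = (\<Sum>j\<in>J i. (g i j - f i j) * c i j0)"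
        by simp
      also have "\<dots> = (sum (g i) (J i) - sum (f i) (J i)) * c i j0"
        by (simp add: sum_subtractf flip: sum_distrib_right)
      finally show ?thesis using g i by simp
    qed simp
    then show "(\<Sum>i\<in>I. \<Sum>j\<in>J i. (g i j - f i j) * c i j) \<ge> 0"
      by simp
  qed
qed

section \<open>The logit formula as equality of costs\<close>

text \<open>
  This is the logit formula after taking logarithms. The right-hand side is the same for all \<open>j\<close>: it
  is the log-sum of the costs, shifted by the logarithm of the total mass. For route choice this
  common value, and not just its existence, matters, because it becomes the cost of a destination.
\<close>

lemma logit_iff_logsum_cost:
  fixes p u :: "'a \<Rightarrow> real"
  assumes fin: "finite J" and ne: "J \<noteq> {}" and \<theta>: "\<theta> > 0" and M: "M > 0" and pos: "p j > 0"
  shows "p j = M * (exp (- \<theta> * u j) / (\<Sum>i\<in>J. exp (- \<theta> * u i))) \<longleftrightarrow>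
         1 / \<theta> * ln (p j) + u j = 1 / \<theta> * ln M + - (1 / \<theta>) * ln (\<Sum>i\<in>J. exp (- \<theta> * u i))"
proof -
  define S where "S = (\<Sum>i\<in>J. exp (- \<theta> * u i))"
  have S: "S > 0"
    unfolding S_def by (intro sum_pos fin ne) simp
  have "p j = M * (exp (- \<theta> * u j) / S) \<longleftrightarrow> ln (p j) = ln (M * (exp (- \<theta> * u j) / S))"
    by (rule ln_inj_iff[symmetric]) (simp_all add: pos M S)
  also have "ln (M * (exp (- \<theta> * u j) / S)) = ln M - \<theta> * u j - ln S"
    using M S by (simp add: ln_mult ln_div)
  also have "ln (p j) = \<dots> \<longleftrightarrow> 1 / \<theta> * ln (p j) + u j = 1 / \<theta> * ln M + - (1 / \<theta>) * ln S"
    using \<theta> by (auto simp: field_simps)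
  finally show ?thesis unfolding S_def .
qed

text \<open>
  A common cost \<open>\<mu>\<close> cannot be anything but the log-sum value: \<open>(1/\<theta>) ln p + u = \<mu>\<close> means
  \<open>p = exp (\<theta> * \<mu>) * exp (- \<theta> * u)\<close>, and summation over \<open>J\<close> determines \<open>\<mu>\<close> from the total mass.
\<close>

lemma logit_iff_constant_cost:
  fixes p u :: "'a \<Rightarrow> real"
  assumes fin: "finite J" and ne: "J \<noteq> {}" and \<theta>: "\<theta> > 0"
    and pos: "\<And>j. j \<in> J \<Longrightarrow> p j > 0" and M: "sum p J = M"
  shows "(\<forall>j\<in>J. p j = M * (exp (- \<theta> * u j) / (\<Sum>i\<in>J. exp (- \<theta> * u i)))) \<longleftrightarrow>
         (\<forall>i\<in>J. \<forall>j\<in>J. 1 / \<theta> * ln (p i) + u i = 1 / \<theta> * ln (p j) + u j)"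
    (is "?logit \<longleftrightarrow> ?const")
proof
  define S where "S = (\<Sum>i\<in>J. exp (- \<theta> * u i))"
  have "M > 0"
    unfolding M[symmetric] by (intro sum_pos fin ne pos)
  then show "?const" if ?logit
    using that logit_iff_logsum_cost[where p = p, OF fin ne \<theta> _ pos] by metis
  assume const: ?const
  from ne obtain j0 where j0: "j0 \<in> J" by blast
  define \<mu> where "\<mu> = 1 / \<theta> * ln (p j0) + u j0"
  have p: "p j = exp (\<theta> * \<mu>) * exp (- \<theta> * u j)" if j: "j \<in> J" for j
  proof -
    have "1 / \<theta> * ln (p j) + u j = \<mu>"
      using const j j0 unfolding \<mu>_def by blast
    then have "ln (p j) = \<theta> * \<mu> + - \<theta> * u j"
      using \<theta> by (auto simp: field_simps)
    then show ?thesis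
      using pos[OF j] by (metis exp_add exp_ln)
  qed
  have "M = exp (\<theta> * \<mu>) * S"
    unfolding M[symmetric] S_def sum_distrib_left using p by (rule sum.cong[OF refl])
  moreover have "S > 0"
    unfolding S_def by (intro sum_pos fin ne) simp
  ultimately have "exp (\<theta> * \<mu>) = M / S"
    by (simp add: field_simps)
  then show ?logit
    using p unfolding S_def by simp
qed

section \<open>Reduction to path flows\<close>

text \<open>
  The coefficient of the path flow deviation on route \<open>k\<close> once link flows and demands have been
  eliminated from the variational inequality.
\<close>

definition marginal_cost ::
  "('v, 'l) pre_digraph \<Rightarrow> real \<Rightarrow> real \<Rightarrow> ('l \<Rightarrow> real \<Rightarrow> real) \<Rightarrow> ('v \<Rightarrow> real \<Rightarrow> real \<Rightarrow> real) \<Rightarrow>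
   ('v \<Rightarrow> real) \<Rightarrow> ('v, 'l) flow_vector \<Rightarrow> 'v \<Rightarrow> 'v \<Rightarrow> 'l list \<Rightarrow> real" where
  "marginal_cost G \<alpha> \<gamma> t A h = (\<lambda>(f, x, q, d) r s k.
     (1 / \<alpha>) * ln (f r s k) + route_cost G t x k + (1 / \<gamma> - 1 / \<alpha>) * ln (q r s) - A s (d s) (h s))"

lemma link_sum_as_path_sum:
  fixes g :: "'r \<Rightarrow> 's \<Rightarrow> 'k \<Rightarrow> real"
  shows "(\<Sum>a\<in>L. (\<Sum>r\<in>R. \<Sum>s\<in>S. \<Sum>k\<in>K r s. m a k * g r s k) * \<tau> a) =
         (\<Sum>r\<in>R. \<Sum>s\<in>S. \<Sum>k\<in>K r s. g r s k * (\<Sum>a\<in>L. m a k * \<tau> a))"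
proof -
  have "(\<Sum>a\<in>L. (\<Sum>r\<in>R. \<Sum>s\<in>S. \<Sum>k\<in>K r s. m a k * g r s k) * \<tau> a) =
        (\<Sum>a\<in>L. \<Sum>r\<in>R. \<Sum>s\<in>S. \<Sum>k\<in>K r s. g r s k * (m a k * \<tau> a))"
    by (simp add: sum_distrib_left sum_distrib_right mult_ac)
  also have "\<dots> = (\<Sum>r\<in>R. \<Sum>a\<in>L. \<Sum>s\<in>S. \<Sum>k\<in>K r s. g r s k * (m a k * \<tau> a))"
    by (rule sum.swap)
  also have "\<dots> = (\<Sum>r\<in>R. \<Sum>s\<in>S. \<Sum>a\<in>L. \<Sum>k\<in>K r s. g r s k * (m a k * \<tau> a))"
    by (intro sum.cong refl sum.swap)
  also have "\<dots> = (\<Sum>r\<in>R. \<Sum>s\<in>S. \<Sum>k\<in>K r s. \<Sum>a\<in>L. g r s k * (m a k * \<tau> a))"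
    by (intro sum.cong refl sum.swap)
  finally show ?thesis
    by (simp add: sum_distrib_left)
qed

lemma K1_VI_as_path_cost:
  assumes z: "(f, x, q, d) \<in> K1 G Or De dem" and z': "(f', x', q', d') \<in> K1 G Or De dem"
  shows "(\<Sum>r\<in>Or. \<Sum>s\<in>De. \<Sum>k\<in>routes G r s. (f' r s k - f r s k) * ((1 / \<alpha>) * ln (f r s k)))
      + (\<Sum>a\<in>arcs G. (x' a - x a) * t a (x a))
      + (\<Sum>r\<in>Or. \<Sum>s\<in>De. (q' r s - q r s) * ((1 / \<gamma> - 1 / \<alpha>) * ln (q r s)))
      - (\<Sum>s\<in>De. (d' s - d s) * A s (d s) (h s)) =
    (\<Sum>r\<in>Or. \<Sum>s\<in>De. \<Sum>k\<in>routes G r s.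
       (f' r s k - f r s k) * marginal_cost G \<alpha> \<gamma> t A h (f, x, q, d) r s k)"
proof -
  define g where "g = (\<lambda>r s k. f' r s k - f r s k)"
  have q: "q' r s - q r s = (\<Sum>k\<in>routes G r s. g r s k)" if "r \<in> Or" "s \<in> De" for r s
    using z z' that by (simp add: K1_def g_def sum_subtractf)
  have x: "x' a - x a = (\<Sum>r\<in>Or. \<Sum>s\<in>De. \<Sum>k\<in>routes G r s. incidence a k * g r s k)"
    if "a \<in> arcs G" for a
    using z z' that by (simp add: K1_def g_def sum_subtractf right_diff_distrib)
  have d: "d' s - d s = (\<Sum>r\<in>Or. q' r s - q r s)" if "s \<in> De" for s
    using z z' that by (simp add: K1_def sum_subtractf)
  have X: "(\<Sum>a\<in>arcs G. (x' a - x a) * t a (x a)) =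
      (\<Sum>r\<in>Or. \<Sum>s\<in>De. \<Sum>k\<in>routes G r s. g r s k * route_cost G t x k)"
    unfolding route_cost_def link_sum_as_path_sum[symmetric] by (simp add: x)
  have Q: "(\<Sum>r\<in>Or. \<Sum>s\<in>De. (q' r s - q r s) * ((1 / \<gamma> - 1 / \<alpha>) * ln (q r s))) =
      (\<Sum>r\<in>Or. \<Sum>s\<in>De. \<Sum>k\<in>routes G r s. g r s k * ((1 / \<gamma> - 1 / \<alpha>) * ln (q r s)))"
    unfolding sum_distrib_right[symmetric] by (simp add: q)
  have "(\<Sum>s\<in>De. (d' s - d s) * A s (d s) (h s)) =
      (\<Sum>s\<in>De. \<Sum>r\<in>Or. (q' r s - q r s) * A s (d s) (h s))"
    unfolding sum_distrib_right[symmetric] by (simp add: d)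
  also have "\<dots> = (\<Sum>r\<in>Or. \<Sum>s\<in>De. (q' r s - q r s) * A s (d s) (h s))"
    by (rule sum.swap)
  also have "\<dots> = (\<Sum>r\<in>Or. \<Sum>s\<in>De. \<Sum>k\<in>routes G r s. g r s k * A s (d s) (h s))"
    unfolding sum_distrib_right[symmetric] by (simp add: q)
  finally have D: "(\<Sum>s\<in>De. (d' s - d s) * A s (d s) (h s)) =
      (\<Sum>r\<in>Or. \<Sum>s\<in>De. \<Sum>k\<in>routes G r s. g r s k * A s (d s) (h s))" .
  show ?thesis
    unfolding X Q D
    by (simp add: marginal_cost_def g_def distrib_left right_diff_distrib sum.distrib sum_subtractf)
qed

text \<open>
  The conservation equations define the link flows and demands of any nonnegative path flow, so the
  only constraint on path flows is the total demand of each origin.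
\<close>

lemma path_flow_extends_to_K1:
  assumes "\<And>r s k. r \<in> Or \<Longrightarrow> s \<in> De \<Longrightarrow> k \<in> routes G r s \<Longrightarrow> f r s k \<ge> 0"
    and "\<And>r. r \<in> Or \<Longrightarrow> (\<Sum>s\<in>De. \<Sum>k\<in>routes G r s. f r s k) = dem r"
  shows "\<exists>x q d. (f, x, q, d) \<in> K1 G Or De dem"
proof (intro exI)
  show "(f, \<lambda>a. \<Sum>r\<in>Or. \<Sum>s\<in>De. \<Sum>k\<in>routes G r s. incidence a k * f r s k,
      \<lambda>r s. \<Sum>k\<in>routes G r s. f r s k, \<lambda>s. \<Sum>r\<in>Or. \<Sum>k\<in>routes G r s. f r s k)
    \<in> K1 G Or De dem"
    using assms by (simp add: K1_def)
qed

lemma solves_VI_iff_marginal_cost_constant: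
  fixes f :: "'v \<Rightarrow> 'v \<Rightarrow> 'l list \<Rightarrow> real" and G :: "('v, 'l) pre_digraph"
    and t :: "'l \<Rightarrow> real \<Rightarrow> real" and A :: "'v \<Rightarrow> real \<Rightarrow> real \<Rightarrow> real"
    and h :: "'v \<Rightarrow> real" and \<alpha> \<gamma> :: real
  assumes fin: "finite Or" "finite De" "\<And>r s. finite (routes G r s)"
    and z: "(f, x, q, d) \<in> K1 G Or De dem"
    and f: "\<And>r s k. r \<in> Or \<Longrightarrow> s \<in> De \<Longrightarrow> k \<in> routes G r s \<Longrightarrow> f r s k > 0"
    and q: "\<And>r s. r \<in> Or \<Longrightarrow> s \<in> De \<Longrightarrow> q r s > 0"
  defines "c \<equiv> marginal_cost G \<alpha> \<gamma> t A h (f, x, q, d)"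
  shows "solves_parametric_VI G Or De dem \<alpha> \<gamma> t A h (f, x, q, d) \<longleftrightarrow>
    (\<forall>r\<in>Or. \<forall>s\<in>De. \<forall>k\<in>routes G r s. \<forall>s'\<in>De. \<forall>k'\<in>routes G r s'. c r s k = c r s' k')"
proof -
  let ?J = "\<lambda>r. SIGMA s:De. routes G r s"
  let ?F = "\<lambda>r (s, k). f r s k" and ?C = "\<lambda>r (s, k). c r s k"
  have Sig: "(\<Sum>s\<in>De. \<Sum>k\<in>routes G r s. g s k) = (\<Sum>(s, k)\<in>?J r. g s k)"
    for r and g :: "'v \<Rightarrow> 'l list \<Rightarrow> real"
    using fin by (intro sum.Sigma) auto
  have dem: "(\<Sum>s\<in>De. \<Sum>k\<in>routes G r s. g r s k) = dem r"
    if "(g, y, p, e) \<in> K1 G Or De dem" "r \<in> Or" for g y p e r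
    using that by (auto simp: K1_def)
  have "solves_parametric_VI G Or De dem \<alpha> \<gamma> t A h (f, x, q, d) \<longleftrightarrow>
      (\<forall>(g, y, p, e) \<in> K1 G Or De dem.
         (\<Sum>r\<in>Or. \<Sum>s\<in>De. \<Sum>k\<in>routes G r s. (g r s k - f r s k) * c r s k) \<ge> 0)"
    unfolding solves_parametric_VI_def c_def prod.case
    by (simp only: z f q simp_thms ball_simps K1_VI_as_path_cost[OF z] split_paired_all
        Ball_def split_paired_All prod.case cong: imp_cong)
  also have "\<dots> \<longleftrightarrow>
      (\<forall>g. (\<forall>r\<in>Or. \<forall>j\<in>?J r. g r j \<ge> 0) \<and> (\<forall>r\<in>Or. sum (g r) (?J r) = sum (?F r) (?J r)) \<longrightarrow>
           (\<Sum>r\<in>Or. \<Sum>j\<in>?J r. (g r j - ?F r j) * ?C r j) \<ge> 0)"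
    (is "?L \<longleftrightarrow> ?R")
  proof
    assume L: ?L
    show ?R
    proof (intro allI impI)
      fix g :: "'v \<Rightarrow> 'v \<times> 'l list \<Rightarrow> real"
      assume g: "(\<forall>r\<in>Or. \<forall>j\<in>?J r. g r j \<ge> 0) \<and> (\<forall>r\<in>Or. sum (g r) (?J r) = sum (?F r) (?J r))"
      have "(\<Sum>s\<in>De. \<Sum>k\<in>routes G r s. g r (s, k)) = dem r" if "r \<in> Or" for r
        using g that dem[OF z that] by (simp add: Sig)
      then obtain y p e where "(\<lambda>r s k. g r (s, k), y, p, e) \<in> K1 G Or De dem"
        using path_flow_extends_to_K1[of Or De G "\<lambda>r s k. g r (s, k)" dem] g by auto
      with L have "(\<Sum>r\<in>Or. \<Sum>s\<in>De. \<Sum>k\<in>routes G r s. (g r (s, k) - f r s k) * c r s k) \<ge> 0"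
        by fastforce
      then show "(\<Sum>r\<in>Or. \<Sum>j\<in>?J r. (g r j - ?F r j) * ?C r j) \<ge> 0"
        by (simp add: Sig case_prod_unfold)
    qed
  next
    assume R: ?R
    show ?L
    proof safe
      fix g y p e
      assume z': "(g, y, p, e) \<in> K1 G Or De dem"
      have "\<forall>r\<in>Or. \<forall>j\<in>?J r. (case j of (s, k) \<Rightarrow> g r s k) \<ge> 0"
        using z' by (auto simp: K1_def)
      moreover have "\<forall>r\<in>Or. (\<Sum>(s, k)\<in>?J r. g r s k) = sum (?F r) (?J r)"
        using dem[OF z] dem[OF z'] by (simp add: Sig)
      ultimately have "(\<Sum>r\<in>Or. \<Sum>j\<in>?J r. ((case j of (s, k) \<Rightarrow> g r s k) - ?F r j) * ?C r j) \<ge> 0"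
        using R[rule_format, of "\<lambda>r (s, k). g r s k"] by blast
      then show "(\<Sum>r\<in>Or. \<Sum>s\<in>De. \<Sum>k\<in>routes G r s. (g r s k - f r s k) * c r s k) \<ge> 0"
        by (simp add: Sig case_prod_unfold)
    qed
  qed
  also have "\<dots> \<longleftrightarrow> (\<forall>r\<in>Or. \<forall>j\<in>?J r. \<forall>j'\<in>?J r. ?C r j = ?C r j')"
    using fin f by (intro VI_on_simplices_iff) auto
  finally show ?thesis
    by (simp add: Ball_def) blast
qed

section \<open>Equilibria\<close>

text \<open>
  Constancy over all pairs (destination, route) splits into constancy over the routes of each
  destination, which is route choice, and constancy over destinations of the resulting log-sum
  cost, which is destination choice.
\<close>

lemma marginal_cost_constant_iff_equilibrium:
  fixes f :: "'v \<Rightarrow> 'v \<Rightarrow> 'l list \<Rightarrow> real" and G :: "('v, 'l) pre_digraph"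
    and t :: "'l \<Rightarrow> real \<Rightarrow> real" and A :: "'v \<Rightarrow> real \<Rightarrow> real \<Rightarrow> real"
    and h :: "'v \<Rightarrow> real" and \<alpha> \<gamma> :: real
  assumes fin: "finite De" "\<And>r s. finite (routes G r s)"
    and ne: "De \<noteq> {}" "\<And>r s. r \<in> Or \<Longrightarrow> s \<in> De \<Longrightarrow> routes G r s \<noteq> {}"
    and \<alpha>: "\<alpha> > 0" and \<gamma>: "\<gamma> > 0"
    and z: "(f, x, q, d) \<in> K1 G Or De dem"
    and f: "\<And>r s k. r \<in> Or \<Longrightarrow> s \<in> De \<Longrightarrow> k \<in> routes G r s \<Longrightarrow> f r s k > 0"
    and q: "\<And>r s. r \<in> Or \<Longrightarrow> s \<in> De \<Longrightarrow> q r s > 0"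
  defines "c \<equiv> marginal_cost G \<alpha> \<gamma> t A h (f, x, q, d)"
  shows "(\<forall>r\<in>Or. \<forall>s\<in>De. \<forall>k\<in>routes G r s. \<forall>s'\<in>De. \<forall>k'\<in>routes G r s'. c r s k = c r s' k') \<longleftrightarrow>
    parametric_equilibrium G Or De dem \<alpha> \<gamma> t A h (f, x, q, d)"
proof -
  define v where "v = expected_cost G \<alpha> t x"
  define w where "w = (\<lambda>r s. v r s - A s (d s) (h s))"
  define route_logit where "route_logit = (\<lambda>r s k. f r s k =
    q r s * (exp (- \<alpha> * route_cost G t x k) / (\<Sum>j\<in>routes G r s. exp (- \<alpha> * route_cost G t x j))))"
  define dest_logit where "dest_logit = (\<lambda>r s. q r s =
    dem r * (exp (- \<gamma> * w r s) / (\<Sum>j\<in>De. exp (- \<gamma> * w r j))))"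

  have route: "(\<forall>k\<in>routes G r s. route_logit r s k) \<longleftrightarrow>
      (\<forall>k\<in>routes G r s. \<forall>k'\<in>routes G r s. c r s k = c r s k')" if rs: "r \<in> Or" "s \<in> De" for r s
  proof -
    have "(\<Sum>k\<in>routes G r s. f r s k) = q r s"
      using z rs by (simp add: K1_def)
    then show ?thesis
      unfolding route_logit_def
      by (subst logit_iff_constant_cost) (use rs fin ne f \<alpha> in \<open>auto simp: c_def marginal_cost_def\<close>)
  qed
  have dest: "(\<forall>s\<in>De. dest_logit r s) \<longleftrightarrow>
      (\<forall>s\<in>De. \<forall>s'\<in>De. 1 / \<gamma> * ln (q r s) + w r s = 1 / \<gamma> * ln (q r s') + w r s')" if r: "r \<in> Or" for r
  proof -
    have "sum (q r) De = dem r"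
      using z r by (simp add: K1_def)
    then show ?thesis
      unfolding dest_logit_def using r fin ne q \<gamma> by (intro logit_iff_constant_cost) auto
  qed
  \<comment> \<open>Under the route formula the entropy terms of \<open>f\<close> and \<open>q\<close> combine: the two multiples
    \<open>1 / \<alpha>\<close> of \<open>ln q\<close> cancel.\<close>
  have logsum: "c r s k = 1 / \<gamma> * ln (q r s) + w r s"
    if rs: "r \<in> Or" "s \<in> De" and k: "k \<in> routes G r s" and logit: "route_logit r s k" for r s k
  proof -
    have "1 / \<alpha> * ln (f r s k) + route_cost G t x k = 1 / \<alpha> * ln (q r s) + v r s"
      using logit_iff_logsum_cost[where p = "f r s" and M = "q r s" and u = "route_cost G t x",
          OF fin(2) ne(2)[OF rs] \<alpha> q[OF rs] f[OF rs k]] logit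
      unfolding route_logit_def v_def expected_cost_def by blast
    then show ?thesis
      by (simp add: c_def marginal_cost_def w_def left_diff_distrib)
  qed
  have "(\<forall>s\<in>De. \<forall>k\<in>routes G r s. \<forall>s'\<in>De. \<forall>k'\<in>routes G r s'. c r s k = c r s' k') \<longleftrightarrow>
      (\<forall>s\<in>De. dest_logit r s) \<and> (\<forall>s\<in>De. \<forall>k\<in>routes G r s. route_logit r s k)"
    (is "?const \<longleftrightarrow> ?logit") if r: "r \<in> Or" for r
  proof
    assume const: ?const
    then have 1: "\<forall>s\<in>De. \<forall>k\<in>routes G r s. route_logit r s k"
      using route[OF r] by blast
    have "1 / \<gamma> * ln (q r s) + w r s = 1 / \<gamma> * ln (q r s') + w r s'"
      if s: "s \<in> De" "s' \<in> De" for s s'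
    proof -
      obtain k k' where "k \<in> routes G r s" "k' \<in> routes G r s'"
        using ne(2)[OF r] s by blast
      then show ?thesis
        using const 1 s logsum[OF r] by metis
    qed
    then have "\<forall>s\<in>De. dest_logit r s"
      unfolding dest[OF r] by blast
    with 1 show ?logit by blast
  next
    assume ?logit
    then show ?const
      unfolding dest[OF r] using logsum[OF r] by metis
  qed
  then show ?thesis
    unfolding parametric_equilibrium_def prod.case
      dest_logit_def w_def v_def route_logit_def by blast
qed

text \<open>
  Logit formulas split a positive total into positive shares, so every equilibrium lies in the
  relative interior of the feasible path flows, where the variational inequality is defined.
\<close>

lemma equilibrium_positive:
  assumes fin: "finite De" "\<And>r s. finite (routes G r s)"
    and dem: "\<And>r. r \<in> Or \<Longrightarrow> dem r > 0"
    and eq: "parametric_equilibrium G Or De dem \<alpha> \<gamma> t A h (f, x, q, d)"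
    and rs: "r \<in> Or" "s \<in> De"
  shows "q r s > 0" and "k \<in> routes G r s \<Longrightarrow> f r s k > 0"
proof -
  show q: "q r s > 0"
  proof -
    have "q r s = dem r * (exp (- \<gamma> * (expected_cost G \<alpha> t x r s - A s (d s) (h s))) /
        (\<Sum>j\<in>De. exp (- \<gamma> * (expected_cost G \<alpha> t x r j - A j (d j) (h j)))))"
      using eq rs unfolding parametric_equilibrium_def prod.case by blast
    also have "\<dots> > 0"
      by (intro mult_pos_pos divide_pos_pos dem sum_pos fin rs exp_gt_zero) (use rs in blast)
    finally show ?thesis .
  qed
  assume k: "k \<in> routes G r s"
  have "f r s k = q r s * (exp (- \<alpha> * route_cost G t x k) /
      (\<Sum>j\<in>routes G r s. exp (- \<alpha> * route_cost G t x j)))"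
    using eq rs k unfolding parametric_equilibrium_def prod.case by blast
  also have "\<dots> > 0"
    by (intro mult_pos_pos divide_pos_pos q sum_pos fin exp_gt_zero) (use k in blast)
  finally show "f r s k > 0" .
qed

theorem theorem1:
  fixes G :: "('v, 'l) pre_digraph" and Or De :: "'v set"
    and dem :: "'v \<Rightarrow> real" and T \<alpha> \<gamma> :: real
    and t :: "'l \<Rightarrow> real \<Rightarrow> real" and A :: "'v \<Rightarrow> real \<Rightarrow> real \<Rightarrow> real"
    and f :: "'v \<Rightarrow> 'v \<Rightarrow> 'l list \<Rightarrow> real" and x :: "'l \<Rightarrow> real"
    and q :: "'v \<Rightarrow> 'v \<Rightarrow> real" and d h :: "'v \<Rightarrow> real"
  assumes "fin_digraph G"
    and "Or \<subseteq> verts G" and "Or \<noteq> {}" and "De \<subseteq> verts G" and "De \<noteq> {}"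
    and "\<And>r s. r \<in> Or \<Longrightarrow> s \<in> De \<Longrightarrow> routes G r s \<noteq> {}"
    and "\<And>r. r \<in> Or \<Longrightarrow> dem r > 0" and "T > 0"
    and "\<alpha> > 0" and "\<gamma> > 0" and "\<alpha> \<ge> \<gamma>"
    and "\<And>a. a \<in> arcs G \<Longrightarrow> travel_time_fun (t a)"
    and "\<And>s. s \<in> De \<Longrightarrow> attraction_fun (A s)"
    and "h \<in> K2 De T"
    and "(f, x, q, d) \<in> K1 G Or De dem"
  shows "solves_parametric_VI G Or De dem \<alpha> \<gamma> t A h (f, x, q, d) \<longleftrightarrow>
         parametric_equilibrium G Or De dem \<alpha> \<gamma> t A h (f, x, q, d)"
proof -
  have fin: "finite Or" "finite De" "\<And>r s. finite (routes G r s)"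
    using assms(1,2,4) fin_digraph.finite_verts finite_routes by (auto intro: finite_subset)
  have iff: ?thesis
    if "\<And>r s k. r \<in> Or \<Longrightarrow> s \<in> De \<Longrightarrow> k \<in> routes G r s \<Longrightarrow> f r s k > 0"
      and "\<And>r s. r \<in> Or \<Longrightarrow> s \<in> De \<Longrightarrow> q r s > 0"
    using solves_VI_iff_marginal_cost_constant[OF fin assms(15) that]
      marginal_cost_constant_iff_equilibrium[OF fin(2,3) assms(5,6,9,10,15) that] by simp
  show ?thesis
  proof
    assume VI: "solves_parametric_VI G Or De dem \<alpha> \<gamma> t A h (f, x, q, d)"
    then show "parametric_equilibrium G Or De dem \<alpha> \<gamma> t A h (f, x, q, d)"
      by (subst iff[symmetric]) (auto simp: solves_parametric_VI_def)
  next
    assume eq: "parametric_equilibrium G Or De dem \<alpha> \<gamma> t A h (f, x, q, d)"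
    then show "solves_parametric_VI G Or De dem \<alpha> \<gamma> t A h (f, x, q, d)"
      using equilibrium_positive[OF fin(2,3) assms(7) eq] by (subst iff) auto
  qed
qed

end
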